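(* Let $\Sigma_L,\Sigma_R$ be two distinct parallel straight lines in $\mathbb{R}^2$. Let $R_C$ be the open strip between them, let $R_L$ be the open half-plane bounded by $\Sigma_L$ and not containing $\Sigma_R$, and let $R_R$ be the open half-plane bounded by $\Sigma_R$ and not containing $\Sigma_L$. Let $X_L,X_C,X_R$ be three linear (i.e. affine) Hamiltonian vector fields on $\mathbb{R}^2$, each of which has an isolated singular point (necessarily a center or a saddle, not required to lie in the corresponding zone). Consider the planar piecewise linear Hamiltonian differential system with three zones defined by $X_i$ on $\overline{R_i}$ for $i=L,C,R$, and suppose it is continuous, i.e. $X_L(p)=X_C(p)$ for every $p\in\Sigma_L$ and $X_C(q)=X_R(q)$ for every $q\in\Sigma_R$. Then this piecewise system has no limit cycles.
   Context: A linear Hamiltonian vector field on $\mathbb{R}^2$ here means a vector field of the form $X(x,y)=(ax+by+\alpha,\; cx-ay+\beta)$ with $a,b,c,\alpha,\beta\in\mathbb{R}$. It is the Hamiltonian vector field $(\partial_y H,-\partial_x H)$ of $H(x,y)=\frac{b}{2}y^2-\frac{c}{2}x^2+axy+\alpha y-\beta x$. Its singular point is isolated if and only if $a^2+bc\neq 0$; it is then a center if $a^2+bc<0$ and a saddle if $a^2+bc>0$. The singular point of each vector field is considered in the whole plane, so it may lie outside the zone in which that vector field is used. A limit cycle is a periodic orbit of the piecewise system that is isolated in the set of all its periodic orbits. *)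

theory Defs
  imports "HOL-Analysis.Analysis"
begin

type_synonym plane = "real \<times> real"

definition straight_line :: "plane set \<Rightarrow> bool" where
  "straight_line S \<longleftrightarrow> affine S \<and> aff_dim S = 1"

definition open_half_plane :: "plane set \<Rightarrow> plane set \<Rightarrow> bool" where
  "open_half_plane S H \<longleftrightarrow>
     (\<exists>n k. n \<noteq> 0 \<and> S = {p. n \<bullet> p = k} \<and> H = {p. n \<bullet> p < k})"

definition open_strip :: "plane set \<Rightarrow> plane set \<Rightarrow> plane set" where
  "open_strip S T = (\<Union>p\<in>S. \<Union>q\<in>T. open_segment p q)"

definition linear_hamiltonian :: "(plane \<Rightarrow> plane) \<Rightarrow> bool" where
  "linear_hamiltonian X \<longleftrightarrow>
     (\<exists>a b c \<alpha> \<beta>. \<forall>x y. X (x, y) = (a * x + b * y + \<alpha>, c * x - a * y + \<beta>))"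

definition has_isolated_singular_point :: "(plane \<Rightarrow> plane) \<Rightarrow> bool" where
  "has_isolated_singular_point X \<longleftrightarrow> (\<exists>p. p isolated_in {q. X q = 0})"

text \<open>When the closed zones cover the plane and the fields agree on the lines where these zones
  meet, the order of the case distinction is irrelevant and the field equals \<open>XL\<close>, \<open>XC\<close>, \<open>XR\<close>
  on \<open>closure RL\<close>, \<open>closure RC\<close>, \<open>closure RR\<close>.\<close>

definition three_zone_field ::
  "plane set \<Rightarrow> plane set \<Rightarrow> plane set \<Rightarrow>
     (plane \<Rightarrow> plane) \<Rightarrow> (plane \<Rightarrow> plane) \<Rightarrow> (plane \<Rightarrow> plane) \<Rightarrow> plane \<Rightarrow> plane" where
  "three_zone_field RL RC RR XL XC XR p =
     (if p \<in> closure RL then XL p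
      else if p \<in> closure RC then XC p
      else if p \<in> closure RR then XR p
      else undefined)"

definition solution_of :: "(plane \<Rightarrow> plane) \<Rightarrow> (real \<Rightarrow> plane) \<Rightarrow> bool" where
  "solution_of F \<gamma> \<longleftrightarrow> (\<forall>t. (\<gamma> has_vector_derivative F (\<gamma> t)) (at t))"

text \<open>Equilibria are not periodic orbits.\<close>

definition periodic_orbit :: "(plane \<Rightarrow> plane) \<Rightarrow> plane set \<Rightarrow> bool" where
  "periodic_orbit F \<Gamma> \<longleftrightarrow>
     (\<exists>\<gamma> T. solution_of F \<gamma> \<and> T > 0 \<and> (\<forall>t. \<gamma> (t + T) = \<gamma> t) \<and>
            (\<exists>s t. \<gamma> s \<noteq> \<gamma> t) \<and> \<Gamma> = range \<gamma>)"

text \<open>Isolated: some neighbourhood of the orbit contains no other periodic orbit.\<close>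

definition limit_cycle :: "(plane \<Rightarrow> plane) \<Rightarrow> plane set \<Rightarrow> bool" where
  "limit_cycle F \<Gamma> \<longleftrightarrow> periodic_orbit F \<Gamma> \<and>
     (\<exists>U. open U \<and> \<Gamma> \<subseteq> U \<and> (\<forall>\<Gamma>'. periodic_orbit F \<Gamma>' \<and> \<Gamma>' \<subseteq> U \<longrightarrow> \<Gamma>' = \<Gamma>))"

end

theory Submission
  imports Defs
begin

text \<open>
  The piecewise field \<open>F\<close> is itself Hamiltonian. Two affine Hamiltonian fields that agree on a
  line \<open>n \<bullet> p = k\<close> differ by \<open>\<nu> * (k - n \<bullet> p)\<close> times the direction \<open>(- snd n, fst n)\<close> of that line:
  the linear part of the difference kills this direction, and having trace zero it maps the normal
  back into it (\<open>linear_hamiltonian_agree_on_line\<close>). Hence \<open>F\<close> is the central field plus two terms,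
  one for each line: a multiple of \<open>max 0 (k - n \<bullet> p)\<close>, with \<open>n\<close> pointing into the strip, times a
  fixed vector along the line. Such a term has the \<open>C\<^sup>1\<close> Hamiltonian
  \<open>(max 0 (k - n \<bullet> p))\<^sup>2 / 2\<close>, up to the factor, and is Lipschitz. So \<open>F\<close> is globally
  Lipschitz and has a \<open>C\<^sup>1\<close> Hamiltonian \<open>H\<close> on the whole plane.

  A globally Lipschitz planar Hamiltonian field has no limit cycle
  (\<open>lipschitz_hamiltonian_no_limit_cycle\<close>). Let \<open>p\<close> be a point of a periodic orbit. On the normal
  segment to the orbit at \<open>p\<close> the function \<open>H\<close> is strictly monotone, because its derivative there
  is the inner product of \<open>F\<close> with \<open>F p\<close>, which is positive near \<open>p\<close>. A solution
  that starts on this segment close to \<open>p\<close> stays close to the periodic one for slightly more than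
  a period, so it crosses the segment again; since \<open>H\<close> is constant along it, it comes back to the very point where it started. It is therefore
  periodic, and it differs from the given orbit because \<open>H\<close> takes another value on it. Such orbits
  exist in every neighbourhood of the given one.

  The argument needs solutions for all initial values (\<open>lipschitz_imp_global_solution\<close>) and their
  continuous dependence on the initial value (\<open>solution_distance_growth\<close>).
\<close>

section \<open>Flows of Lipschitz fields\<close>

lemma has_vector_derivative_reflect:
  assumes "(f has_vector_derivative f') (at (- t))"
  shows "((\<lambda>s. f (- s)) has_vector_derivative - f') (at t)"
proof -
  have "(uminus has_vector_derivative (- 1 :: real)) (at t)"
    unfolding has_real_derivative_iff_has_vector_derivative[symmetric]
    by (auto intro!: derivative_eq_intros)
  from vector_diff_chain_at[OF this assms] show ?thesis by (simp add: o_def)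
qed

text \<open>The growth rate \<open>K\<close> is preserved by integration while the constant \<open>C\<close> is divided by \<open>K\<close>. For
  large \<open>K\<close> this makes the Picard operator a contraction on the whole real line at once.\<close>

lemma antiderivative_exp_bound:
  fixes A G :: "real \<Rightarrow> 'a::real_normed_vector"
  assumes deriv: "\<And>t. (A has_vector_derivative G t) (at t)" and "A 0 = 0"
    and bound: "\<And>t. norm (G t) \<le> C * exp (K * \<bar>t\<bar>)" and "K > 0"
  shows "norm (A t) \<le> C / K * exp (K * \<bar>t\<bar>)"
proof -
  have forward: "norm (B t) \<le> C / K * exp (K * t)"
    if t: "0 \<le> t" and B: "\<And>t. (B has_vector_derivative E t) (at t)" "B 0 = 0"
      and E: "\<And>t. norm (E t) \<le> C * exp (K * \<bar>t\<bar>)" for B E :: "real \<Rightarrow> 'a" and t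
  proof (cases "t = 0")
    case True
    have "0 \<le> C" using order_trans[OF norm_ge_zero E[of 0]] by simp
    then show ?thesis using True B(2) \<open>K > 0\<close> by simp
  next
    case False
    have "norm (B t - B 0) \<le> C / K * exp (K * t) - C / K * exp (K * 0)"
    proof (rule differentiable_bound_general)
      show "0 < t" using t False by simp
      show "continuous_on {0..t} B"
        using B(1) by (meson continuous_at_imp_continuous_on has_vector_derivative_continuous)
      show "continuous_on {0..t} (\<lambda>s. C / K * exp (K * s))"
        by (intro continuous_intros)
      show "(B has_vector_derivative E s) (at s)" for s by (rule B(1))
      show "((\<lambda>s. C / K * exp (K * s)) has_vector_derivative C * exp (K * s)) (at s)" for s
        using \<open>K > 0\<close> unfolding has_real_derivative_iff_has_vector_derivative[symmetric]
        by (auto intro!: derivative_eq_intros)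
      show "norm (E s) \<le> C * exp (K * s)" if "0 < s" for s using E[of s] that by simp
    qed
    moreover have "0 \<le> C" using order_trans[OF norm_ge_zero E[of 0]] by simp
    then have "0 \<le> C / K" using \<open>K > 0\<close> by simp
    ultimately show ?thesis using B(2) by simp
  qed
  show ?thesis
  proof (cases "0 \<le> t")
    case True
    then show ?thesis using forward[of t A G] assms by simp
  next
    case False
    have "((\<lambda>s. A (- s)) has_vector_derivative - G (- s)) (at s)" for s
      by (rule has_vector_derivative_reflect[OF deriv])
    then show ?thesis
      using forward[of "- t" "\<lambda>s. A (- s)" "\<lambda>s. - G (- s)"] False \<open>A 0 = 0\<close> bound[of "- s" for s] by simp
  qed
qed

text \<open>Picard iteration in the space of functions of growth at most \<open>exp (K * \<bar>t\<bar>)\<close>, where \<open>K\<close> exceeds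
  the Lipschitz constant. A function in this space is represented by its bounded quotient
  \<open>u\<close> by \<open>exp (K * \<bar>t\<bar>)\<close>; since the contraction works for all times simultaneously, no local
  solutions need to be glued.\<close>

theorem lipschitz_imp_global_solution:
  fixes F :: "'a::euclidean_space \<Rightarrow> 'a"
  assumes lip: "L-lipschitz_on UNIV F"
  shows "\<exists>\<gamma>. \<gamma> 0 = x0 \<and> (\<forall>t. (\<gamma> has_vector_derivative F (\<gamma> t)) (at t))"
proof -
  have "L \<ge> 0" using lip lipschitz_on_nonneg by blast
  \<comment> \<open>The Picard operator contracts by the factor \<open>L / K\<close>.\<close>
  define K where "K = L + 1"
  have K: "K > 0" "L / K < 1" "0 \<le> L / K" using \<open>L \<ge> 0\<close> by (auto simp: K_def)
  \<comment> \<open>\<open>G u\<close> is the field along the curve represented by \<open>u\<close>, and \<open>A u\<close> is its integral from 0.\<close>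
  define G where "G u s = F (exp (K * \<bar>s\<bar>) *\<^sub>R apply_bcontfun u s)" for u s
  have cont_G: "continuous_on UNIV (G u)" for u
  proof -
    have "continuous_on UNIV F" using lip lipschitz_on_continuous_on by blast
    then show ?thesis unfolding G_def
      by (rule continuous_on_compose2) (auto intro!: continuous_intros)
  qed
  have "\<exists>A. A 0 = 0 \<and> (\<forall>t. (A has_vector_derivative G u t) (at t))" for u
  proof -
    have "\<exists>A. \<forall>x. (-\<infinity>::ereal) < ereal x \<longrightarrow> ereal x < \<infinity> \<longrightarrow> (A has_vector_derivative G u x) (at x)"
      by (rule einterval_antiderivative)
        (use cont_G[of u] in \<open>auto simp: continuous_on_eq_continuous_at\<close>)
    then obtain A where A: "\<And>x. (A has_vector_derivative G u x) (at x)" by auto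
    then have "((\<lambda>t. A t - A 0) has_vector_derivative G u x) (at x)" for x
      using has_vector_derivative_diff[OF A has_vector_derivative_const] by simp
    then show ?thesis by (intro exI[of _ "\<lambda>t. A t - A 0"]) auto
  qed
  then obtain A where A: "\<And>u. A u 0 = 0" "\<And>u t. (A u has_vector_derivative G u t) (at t)"
    by metis
  \<comment> \<open>\<open>Q u\<close> represents the Picard iterate \<open>x0 + A u\<close>.\<close>
  define Q where "Q u t = exp (- K * \<bar>t\<bar>) *\<^sub>R (x0 + A u t)" for u t
  have Q_bcontfun: "Q u \<in> bcontfun" for u
  proof (rule bcontfun_normI)
    have "continuous_on UNIV (A u)"
      using A(2) by (meson continuous_at_imp_continuous_on has_vector_derivative_continuous)
    then show "continuous_on UNIV (Q u)"
      unfolding Q_def by (intro continuous_intros)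
    fix t
    have "norm (G u s) \<le> (norm (F 0) + L * norm u) * exp (K * \<bar>s\<bar>)" for s
    proof -
      have "norm (G u s) \<le> norm (F 0) + norm (G u s - F 0)"
        using norm_triangle_sub by blast
      also have "norm (G u s - F 0) \<le> L * (exp (K * \<bar>s\<bar>) * norm (apply_bcontfun u s))"
        using lipschitz_onD[OF lip, of "exp (K * \<bar>s\<bar>) *\<^sub>R apply_bcontfun u s" 0]
        by (simp add: G_def dist_norm)
      also have "\<dots> \<le> L * (exp (K * \<bar>s\<bar>) * norm u)"
        using \<open>L \<ge> 0\<close> norm_bounded[of u s] by (intro mult_left_mono) auto
      also have "norm (F 0) \<le> norm (F 0) * exp (K * \<bar>s\<bar>)"
        using K by (simp add: mult_le_cancel_left1)
      finally show ?thesis by (simp add: algebra_simps)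
    qed
    from antiderivative_exp_bound[OF A(2) A(1) this K(1), of t]
    have A_bound: "norm (A u t) \<le> (norm (F 0) + L * norm u) / K * exp (K * \<bar>t\<bar>)" .
    have "norm (Q u t) \<le> exp (- K * \<bar>t\<bar>) * (norm x0 + norm (A u t))"
      unfolding Q_def by (simp add: norm_triangle_ineq)
    also have "\<dots> \<le> exp (- K * \<bar>t\<bar>)
        * (norm x0 * exp (K * \<bar>t\<bar>) + (norm (F 0) + L * norm u) / K * exp (K * \<bar>t\<bar>))"
      using A_bound K by (intro mult_left_mono add_mono) (auto simp: mult_le_cancel_left1)
    also have "\<dots> = norm x0 + (norm (F 0) + L * norm u) / K"
      by (simp add: exp_minus field_simps)
    finally show "norm (Q u t) \<le> norm x0 + (norm (F 0) + L * norm u) / K" .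
  qed
  define P where "P u = Bcontfun (Q u)" for u
  have P: "apply_bcontfun (P u) = Q u" for u
    unfolding P_def by (rule Bcontfun_inverse[OF Q_bcontfun])
  have "dist (P u) (P v) \<le> L / K * dist u v" for u v
  proof (rule dist_bound)
    fix t
    have "norm (G u s - G v s) \<le> (L * dist u v) * exp (K * \<bar>s\<bar>)" for s
    proof -
      have "norm (G u s - G v s) \<le> L * (exp (K * \<bar>s\<bar>) * dist (apply_bcontfun u s) (apply_bcontfun v s))"
        using lipschitz_onD[OF lip, of "exp (K * \<bar>s\<bar>) *\<^sub>R apply_bcontfun u s"
            "exp (K * \<bar>s\<bar>) *\<^sub>R apply_bcontfun v s"]
        by (simp add: G_def dist_norm flip: scaleR_diff_right)
      also have "\<dots> \<le> L * (exp (K * \<bar>s\<bar>) * dist u v)"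
        using \<open>L \<ge> 0\<close> dist_bounded[of u s v] by (intro mult_left_mono) auto
      finally show ?thesis by (simp add: algebra_simps)
    qed
    moreover have "((\<lambda>t. A u t - A v t) has_vector_derivative G u t - G v t) (at t)" for t
      by (intro has_vector_derivative_diff A)
    ultimately have "norm (A u t - A v t) \<le> L * dist u v / K * exp (K * \<bar>t\<bar>)"
      using antiderivative_exp_bound[of "\<lambda>t. A u t - A v t" "\<lambda>t. G u t - G v t"] A(1) K(1) by simp
    moreover have "dist (apply_bcontfun (P u) t) (apply_bcontfun (P v) t)
        = exp (- K * \<bar>t\<bar>) * norm (A u t - A v t)"
      by (simp add: P Q_def dist_norm flip: scaleR_diff_right)
    ultimately have "dist (apply_bcontfun (P u) t) (apply_bcontfun (P v) t)
        \<le> exp (- K * \<bar>t\<bar>) * (L * dist u v / K * exp (K * \<bar>t\<bar>))"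
      by (metis mult_left_mono exp_ge_zero)
    then show "dist (apply_bcontfun (P u) t) (apply_bcontfun (P v) t) \<le> L / K * dist u v"
      by (simp add: exp_minus field_simps)
  qed
  then obtain u where u: "P u = u"
    using banach_fix_type[OF K(3,2)] by blast
  define \<gamma> where "\<gamma> t = x0 + A u t" for t
  have "exp (K * \<bar>t\<bar>) *\<^sub>R apply_bcontfun u t = \<gamma> t" for t
    using P[of u] unfolding u Q_def \<gamma>_def by (simp add: exp_minus)
  then have "(\<gamma> has_vector_derivative F (\<gamma> t)) (at t)" for t
    using has_vector_derivative_add[OF has_vector_derivative_const[of x0] A(2)[of u t]]
    unfolding G_def \<gamma>_def by simp
  then show ?thesis by (intro exI[of _ \<gamma>]) (auto simp: \<gamma>_def A)
qed

text \<open>Gronwall in differential form: the squared distance \<open>z \<bullet> z\<close> has derivative at most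
  \<open>2 * L * (z \<bullet> z)\<close>, so its product with \<open>exp (- 2 * L * t)\<close> does not increase.\<close>

lemma solution_distance_growth_forward:
  fixes F :: "'a::real_inner \<Rightarrow> 'a"
  assumes lip: "L-lipschitz_on UNIV F"
    and \<gamma>: "\<And>t. (\<gamma> has_vector_derivative F (\<gamma> t)) (at t)"
    and \<delta>: "\<And>t. (\<delta> has_vector_derivative F (\<delta> t)) (at t)" and "t \<ge> 0"
  shows "dist (\<gamma> t) (\<delta> t) \<le> dist (\<gamma> 0) (\<delta> 0) * exp (L * t)"
proof -
  define z where "z t = \<gamma> t - \<delta> t" for t
  define z' where "z' t = F (\<gamma> t) - F (\<delta> t)" for t
  define q where "q t = exp (- 2 * L * t) * (z t \<bullet> z t)" for t
  have "q t \<le> q 0"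
  proof (rule DERIV_nonpos_imp_nonincreasing[OF \<open>t \<ge> 0\<close>])
    fix s
    have "(z has_vector_derivative z' s) (at s)"
      unfolding z_def z'_def by (intro has_vector_derivative_diff \<gamma> \<delta>)
    then have "((\<lambda>t. z t \<bullet> z t) has_real_derivative 2 * (z s \<bullet> z' s)) (at s)"
      unfolding has_vector_derivative_def has_field_derivative_def
      by (auto intro!: derivative_eq_intros simp: inner_commute)
    then have "(q has_real_derivative
        exp (- 2 * L * s) * (2 * (z s \<bullet> z' s)) + - 2 * L * exp (- 2 * L * s) * (z s \<bullet> z s)) (at s)"
      unfolding q_def by (auto intro!: derivative_eq_intros)
    moreover have "z s \<bullet> z' s \<le> L * (z s \<bullet> z s)"
    proof -
      have "z s \<bullet> z' s \<le> norm (z s) * norm (z' s)" by (rule norm_cauchy_schwarz)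
      also have "\<dots> \<le> norm (z s) * (L * norm (z s))"
        using lipschitz_onD[OF lip, of "\<gamma> s" "\<delta> s"]
        by (intro mult_left_mono) (auto simp: z_def z'_def dist_norm)
      finally show ?thesis by (simp add: dot_square_norm power2_eq_square ac_simps)
    qed
    then have "exp (- 2 * L * s) * (2 * (z s \<bullet> z' s)) + - 2 * L * exp (- 2 * L * s) * (z s \<bullet> z s) \<le> 0"
      using mult_left_mono[of "z s \<bullet> z' s" "L * (z s \<bullet> z s)" "2 * exp (- 2 * L * s)"]
      by (simp add: algebra_simps)
    ultimately show "\<exists>y. (q has_real_derivative y) (at s) \<and> y \<le> 0" by blast
  qed
  then have "exp (2 * L * t) * q t \<le> exp (2 * L * t) * q 0" by simp
  then have "(norm (z t))\<^sup>2 \<le> exp (2 * L * t) * (norm (z 0))\<^sup>2"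
    by (simp add: q_def exp_minus dot_square_norm field_simps)
  also have "\<dots> = (norm (z 0) * exp (L * t))\<^sup>2"
    by (simp add: power_mult_distrib flip: exp_double)
  finally show ?thesis
    unfolding z_def dist_norm by (rule power2_le_imp_le) simp
qed

text \<open>Negative times reduce to positive ones: time reversal turns solutions of \<open>F\<close> into solutions of
  \<open>- F\<close>.\<close>

lemma solution_distance_growth:
  fixes F :: "'a::real_inner \<Rightarrow> 'a"
  assumes lip: "L-lipschitz_on UNIV F"
    and \<gamma>: "\<And>t. (\<gamma> has_vector_derivative F (\<gamma> t)) (at t)"
    and \<delta>: "\<And>t. (\<delta> has_vector_derivative F (\<delta> t)) (at t)"
  shows "dist (\<gamma> t) (\<delta> t) \<le> dist (\<gamma> 0) (\<delta> 0) * exp (L * \<bar>t\<bar>)"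
proof (cases "t \<ge> 0")
  case True
  then show ?thesis using solution_distance_growth_forward[OF assms] by simp
next
  case False
  have reverse: "((\<lambda>s. \<phi> (- s)) has_vector_derivative - F (\<phi> (- s))) (at s)"
    if "\<And>t. (\<phi> has_vector_derivative F (\<phi> t)) (at t)" for \<phi> s
    by (rule has_vector_derivative_reflect[OF that])
  have "L-lipschitz_on UNIV (\<lambda>x. - F x)" using lip by (rule lipschitz_on_minus)
  from solution_distance_growth_forward[OF this reverse[OF \<gamma>] reverse[OF \<delta>], of "- t"] False
  show ?thesis by simp
qed

lemma lipschitz_solution_unique:
  fixes F :: "'a::real_inner \<Rightarrow> 'a"
  assumes "L-lipschitz_on UNIV F"
    and "\<And>t. (\<gamma> has_vector_derivative F (\<gamma> t)) (at t)"
    and "\<And>t. (\<delta> has_vector_derivative F (\<delta> t)) (at t)"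
    and "\<gamma> 0 = \<delta> 0"
  shows "\<gamma> t = \<delta> t"
  using solution_distance_growth[OF assms(1-3), of t] assms(4) by simp

section \<open>Planar Hamiltonian fields\<close>

text \<open>The formula is the derivative of \<open>H\<close> when \<open>F\<close> is \<open>(\<partial>\<^sub>y H, - \<partial>\<^sub>x H)\<close>. Stating it for the total
  derivative makes the chain rule available along curves and segments.\<close>

definition hamiltonian_field :: "(plane \<Rightarrow> plane) \<Rightarrow> (plane \<Rightarrow> real) \<Rightarrow> bool" where
  "hamiltonian_field F H \<longleftrightarrow>
     (\<forall>p. (H has_derivative (\<lambda>u. fst (F p) * snd u - snd (F p) * fst u)) (at p))"

lemma solution_conserves_hamiltonian:
  assumes "hamiltonian_field F H" and "solution_of F \<gamma>"
  shows "H (\<gamma> s) = H (\<gamma> t)"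
proof -
  have "((\<lambda>t. H (\<gamma> t)) has_real_derivative 0) (at t)" for t
  proof -
    have "(\<gamma> has_derivative (\<lambda>h. h *\<^sub>R F (\<gamma> t))) (at t)"
      using assms(2) by (simp add: solution_of_def has_vector_derivative_def)
    moreover have "(H has_derivative
        (\<lambda>u. fst (F (\<gamma> t)) * snd u - snd (F (\<gamma> t)) * fst u)) (at (\<gamma> t))"
      using assms(1) unfolding hamiltonian_field_def by blast
    ultimately have "((\<lambda>t. H (\<gamma> t)) has_derivative
        (\<lambda>h. fst (F (\<gamma> t)) * snd (h *\<^sub>R F (\<gamma> t)) - snd (F (\<gamma> t)) * fst (h *\<^sub>R F (\<gamma> t)))) (at t)"
      by (rule has_derivative_compose)
    then show ?thesis
      unfolding has_field_derivative_def by (rule has_derivative_eq_rhs) (auto simp: fun_eq_iff)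
  qed
  then show ?thesis using DERIV_isconst_all by blast
qed

text \<open>The translate of a solution by \<open>\<tau>\<close> is a solution with the same initial value, hence the same
  solution. The second conclusion confines the orbit to the time interval on which it can be
  compared with other solutions.\<close>

lemma solution_return_imp_periodic_orbit:
  assumes lip: "L-lipschitz_on UNIV F" and sol: "solution_of F \<delta>"
    and "\<tau> > 0" "\<delta> \<tau> = \<delta> 0" and "F (\<delta> 0) \<noteq> 0"
  shows "periodic_orbit F (range \<delta>)" and "range \<delta> = \<delta> ` {0..\<tau>}"
proof -
  have D: "(\<delta> has_vector_derivative F (\<delta> t)) (at t)" for t
    using sol by (simp add: solution_of_def)
  have "((\<lambda>t. \<delta> (t + \<tau>)) has_vector_derivative F (\<delta> (t + \<tau>))) (at t)" for t
  proof -
    have "((\<lambda>t. t + \<tau>) has_vector_derivative 1) (at t)"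
      unfolding has_real_derivative_iff_has_vector_derivative[symmetric]
      by (auto intro!: derivative_eq_intros)
    from vector_diff_chain_at[OF this D] show ?thesis by (simp add: o_def)
  qed
  from lipschitz_solution_unique[OF lip this D] \<open>\<delta> \<tau> = \<delta> 0\<close>
  have period: "\<delta> (t + \<tau>) = \<delta> t" for t by simp
  have "\<exists>s t. \<delta> s \<noteq> \<delta> t"
  proof (rule ccontr)
    assume "\<not> ?thesis"
    then have "\<delta> = (\<lambda>_. \<delta> 0)" by blast
    then have "(\<delta> has_vector_derivative 0) (at 0)"
      by (metis has_vector_derivative_const)
    with D[of 0] \<open>F (\<delta> 0) \<noteq> 0\<close> show False
      using vector_derivative_unique_at by blast
  qed
  then show "periodic_orbit F (range \<delta>)"
    unfolding periodic_orbit_def using sol \<open>\<tau> > 0\<close> period by blast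
  have shift: "\<delta> (t + of_int k * \<tau>) = \<delta> t" for t and k :: int
  proof (induction k rule: int_induct[of _ 0])
    case (step1 i)
    then show ?case using period[of "t + of_int i * \<tau>"] by (simp add: algebra_simps)
  next
    case (step2 i)
    then show ?case using period[of "t + of_int (i - 1) * \<tau>"] by (simp add: algebra_simps)
  qed simp
  have "\<delta> t \<in> \<delta> ` {0..\<tau>}" for t
  proof
    show "\<delta> t = \<delta> (t + of_int (- \<lfloor>t / \<tau>\<rfloor>) * \<tau>)" by (rule shift[symmetric])
    have "0 \<le> (t / \<tau> - of_int \<lfloor>t / \<tau>\<rfloor>) * \<tau>" "(t / \<tau> - of_int \<lfloor>t / \<tau>\<rfloor>) * \<tau> \<le> 1 * \<tau>"
      using \<open>\<tau> > 0\<close> by (auto intro!: mult_nonneg_nonneg mult_right_mono) linarith+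
    then show "t + of_int (- \<lfloor>t / \<tau>\<rfloor>) * \<tau> \<in> {0..\<tau>}"
      using \<open>\<tau> > 0\<close> by (simp add: algebra_simps)
  qed
  then show "range \<delta> = \<delta> ` {0..\<tau>}" by blast
qed

text \<open>The section through \<open>p\<close> is orthogonal to the field. The derivative of \<open>H\<close> along it at \<open>q\<close> is
  \<open>F q \<bullet> F p\<close>, which is positive as long as \<open>F q\<close> differs from \<open>F p\<close> by less than the norm of
  \<open>F p\<close>; the Lipschitz bound guarantees this for parameters below \<open>1 / L\<close>.\<close>

lemma hamiltonian_inj_on_section:
  assumes ham: "hamiltonian_field F H" and lip: "L-lipschitz_on UNIV F"
    and "F p \<noteq> 0" and w: "w = (- snd (F p), fst (F p))"
    and s: "L * \<bar>s\<bar> < 1" "L * \<bar>s'\<bar> < 1"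
    and eq: "H (p + s *\<^sub>R w) = H (p + s' *\<^sub>R w)"
  shows "s = s'"
proof -
  have increasing: "H (p + a *\<^sub>R w) < H (p + b *\<^sub>R w)"
    if "a < b" and ab: "L * \<bar>a\<bar> < 1" "L * \<bar>b\<bar> < 1" for a b
  proof (rule DERIV_pos_imp_increasing[OF \<open>a < b\<close>])
    fix c assume c: "a \<le> c" "c \<le> b"
    let ?q = "p + c *\<^sub>R w"
    have "L \<ge> 0" using lip lipschitz_on_nonneg by blast
    have "\<bar>c\<bar> \<le> max \<bar>a\<bar> \<bar>b\<bar>" using c by linarith
    then have "L * \<bar>c\<bar> \<le> L * max \<bar>a\<bar> \<bar>b\<bar>" using \<open>L \<ge> 0\<close> by (intro mult_left_mono) auto
    also have "\<dots> < 1" using ab by (simp add: max_def)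
    finally have Lc: "L * \<bar>c\<bar> < 1" .
    have "((\<lambda>c. p + c *\<^sub>R w) has_derivative (\<lambda>h. h *\<^sub>R w)) (at c)"
      by (auto intro!: derivative_eq_intros)
    moreover have "(H has_derivative (\<lambda>u. fst (F ?q) * snd u - snd (F ?q) * fst u)) (at ?q)"
      using ham unfolding hamiltonian_field_def by blast
    ultimately have "((\<lambda>c. H (p + c *\<^sub>R w)) has_derivative
        (\<lambda>h. fst (F ?q) * snd (h *\<^sub>R w) - snd (F ?q) * fst (h *\<^sub>R w))) (at c)"
      by (rule has_derivative_compose)
    then have "((\<lambda>c. H (p + c *\<^sub>R w)) has_real_derivative F ?q \<bullet> F p) (at c)"
      unfolding has_field_derivative_def
      by (rule has_derivative_eq_rhs) (auto simp: fun_eq_iff w inner_prod_def algebra_simps)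
    moreover have "F ?q \<bullet> F p > 0"
    proof -
      have "norm w = norm (F p)" by (simp add: w norm_prod_def)
      then have "norm (F ?q - F p) \<le> L * (\<bar>c\<bar> * norm (F p))"
        using lipschitz_onD[OF lip, of ?q p] by (simp add: dist_norm)
      moreover have "\<bar>(F ?q - F p) \<bullet> F p\<bar> \<le> norm (F ?q - F p) * norm (F p)"
        by (rule Cauchy_Schwarz_ineq2)
      ultimately have "\<bar>(F ?q - F p) \<bullet> F p\<bar> \<le> L * (\<bar>c\<bar> * norm (F p)) * norm (F p)"
        by (meson mult_right_mono norm_ge_zero order_trans)
      also have "\<dots> = L * \<bar>c\<bar> * (F p \<bullet> F p)"
        by (simp add: dot_square_norm power2_eq_square)
      also have "\<dots> < 1 * (F p \<bullet> F p)"
        using Lc \<open>F p \<noteq> 0\<close> by (intro mult_strict_right_mono) auto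
      finally show ?thesis by (simp add: inner_diff_left)
    qed
    ultimately show "\<exists>y. ((\<lambda>c. H (p + c *\<^sub>R w)) has_real_derivative y) (at c) \<and> 0 < y" by blast
  qed
  show ?thesis
    using increasing[of s s'] increasing[of s' s] s eq by (cases s s' rule: linorder_cases) auto
qed

lemma orthogonal_in_plane:
  fixes v z :: plane
  assumes "v \<bullet> z = 0" "v \<noteq> 0"
  obtains c where "z = c *\<^sub>R (- snd v, fst v)"
proof
  have pos: "fst v * fst v + snd v * snd v \<noteq> 0"
    using \<open>v \<noteq> 0\<close> by (metis inner_eq_zero_iff inner_prod_def inner_real_def)
  have o: "fst v * fst z + snd v * snd z = 0"
    using assms(1) by (simp add: inner_prod_def)
  let ?c = "(fst v * snd z - snd v * fst z) / (fst v * fst v + snd v * snd v)"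
  have "(fst v * snd z - snd v * fst z) * - snd v = fst z * (fst v * fst v + snd v * snd v)"
    "(fst v * snd z - snd v * fst z) * fst v = snd z * (fst v * fst v + snd v * snd v)"
    using o by algebra+
  then show "z = ?c *\<^sub>R (- snd v, fst v)"
    using pos by (auto simp: prod_eq_iff field_simps)
qed

text \<open>The return map of the section through a point \<open>p\<close> of the periodic orbit is the identity, because
  it preserves \<open>H\<close> and \<open>H\<close> is injective on the section. So the nearby solutions are periodic too.\<close>

theorem lipschitz_hamiltonian_no_limit_cycle:
  assumes ham: "hamiltonian_field F H" and lip: "L-lipschitz_on UNIV F"
  shows "\<not> limit_cycle F \<Gamma>"
proof
  assume "limit_cycle F \<Gamma>"
  then have "periodic_orbit F \<Gamma>"
    and "\<exists>U. open U \<and> \<Gamma> \<subseteq> U \<and> (\<forall>\<Gamma>'. periodic_orbit F \<Gamma>' \<and> \<Gamma>' \<subseteq> U \<longrightarrow> \<Gamma>' = \<Gamma>)"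
    unfolding limit_cycle_def by simp_all
  then obtain U where U: "open U" "\<Gamma> \<subseteq> U"
    and isolated: "\<And>\<Gamma>'. periodic_orbit F \<Gamma>' \<Longrightarrow> \<Gamma>' \<subseteq> U \<Longrightarrow> \<Gamma>' = \<Gamma>"
    by auto
  from \<open>periodic_orbit F \<Gamma>\<close> obtain \<gamma> T where sol: "solution_of F \<gamma>"
    and T: "T > 0" "\<And>t. \<gamma> (t + T) = \<gamma> t"
    and nonconst: "\<exists>s t. \<gamma> s \<noteq> \<gamma> t" and \<Gamma>: "\<Gamma> = range \<gamma>"
    unfolding periodic_orbit_def by metis
  have D: "(\<gamma> has_vector_derivative F (\<gamma> t)) (at t)" for t
    using sol by (simp add: solution_of_def)
  have "L \<ge> 0" using lip lipschitz_on_nonneg by blast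
  define p where "p = \<gamma> 0"
  define v where "v = F p"
  define w where "w = (- snd v, fst v)"
  have \<gamma>T: "\<gamma> T = p" using T(2)[of 0] by (simp add: p_def)
  have "v \<noteq> 0"
  proof
    assume "v = 0"
    then have const: "((\<lambda>_. p) has_vector_derivative F p) (at t)" for t :: real
      by (simp add: v_def)
    have "\<gamma> t = p" for t
      by (rule lipschitz_solution_unique[OF lip D const p_def[symmetric]])
    with nonconst show False by simp
  qed
  have norm_w: "norm w = norm v" by (simp add: w_def norm_prod_def)
  have "continuous_on UNIV \<gamma>"
    using D by (meson continuous_at_imp_continuous_on has_vector_derivative_continuous)
  then have "compact (\<gamma> ` {0..T})"
    by (meson compact_Icc compact_continuous_image continuous_on_subset subset_UNIV)
  moreover have "\<Gamma> = \<gamma> ` {0..T}"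
    unfolding \<Gamma> using solution_return_imp_periodic_orbit(2)[OF lip sol T(1)] \<gamma>T \<open>v \<noteq> 0\<close>
    by (simp add: p_def v_def)
  ultimately obtain \<rho> where \<rho>: "\<rho> > 0" "(\<Union>x\<in>\<Gamma>. ball x \<rho>) \<subseteq> U"
    using compact_subset_open_imp_ball_epsilon_subset[of \<Gamma> U] U by metis
  \<comment> \<open>A point of the section at distance less than \<open>2 * r\<close> from \<open>p\<close> has its parameter in the range
    where \<open>H\<close> is injective.\<close>
  define r where "r = norm v / (2 * (L + 1))"
  have "r > 0" using \<open>v \<noteq> 0\<close> \<open>L \<ge> 0\<close> by (simp add: r_def)
  \<comment> \<open>\<open>g t\<close> is 0 exactly when \<open>\<gamma> t\<close> is on the line that carries the section, and the periodic solution crosses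
    this line transversally at time \<open>T\<close>.\<close>
  define g where "g t = v \<bullet> (\<gamma> t - p)" for t
  have "(g has_real_derivative v \<bullet> v) (at T)"
  proof -
    have "F (\<gamma> T) = v" by (simp add: \<gamma>T v_def)
    then have "(\<gamma> has_derivative (\<lambda>h. h *\<^sub>R v)) (at T)"
      using D[of T] by (simp add: has_vector_derivative_def)
    then show ?thesis
      unfolding g_def has_field_derivative_def
      by (auto intro!: derivative_eq_intros simp: fun_eq_iff)
  qed
  moreover have "v \<bullet> v > 0" using \<open>v \<noteq> 0\<close> by simp
  ultimately obtain d1 d2 where "d1 > 0" "d2 > 0"
    and d1: "\<And>h. h > 0 \<Longrightarrow> h < d1 \<Longrightarrow> g T < g (T + h)"
    and d2: "\<And>h. h > 0 \<Longrightarrow> h < d2 \<Longrightarrow> g (T - h) < g T"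
    using DERIV_pos_inc_right[of g] DERIV_pos_inc_left[of g] by metis
  have "isCont \<gamma> T" using D has_vector_derivative_continuous by blast
  then obtain d3 where "d3 > 0" and d3: "\<And>t. \<bar>t - T\<bar> < d3 \<Longrightarrow> dist (\<gamma> t) p < r"
    unfolding continuous_at_eps_delta using \<open>r > 0\<close> \<gamma>T by (auto simp: dist_real_def)
  define h where "h = min (min d1 d2) (min d3 T) / 2"
  have h: "h > 0" "h < d1" "h < d2" "h < d3" "h < T"
    using \<open>d1 > 0\<close> \<open>d2 > 0\<close> \<open>d3 > 0\<close> T(1) by (auto simp: h_def)
  have gT: "g T = 0" by (simp add: g_def \<gamma>T)
  have g_signs: "g (T - h) < 0" "0 < g (T + h)"
    using d1[of h] d2[of h] h gT by auto
  \<comment> \<open>A solution that stays within \<open>\<mu>\<close> of the periodic one stays in \<open>U\<close>, is at distance less than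
    \<open>2 * r\<close> from \<open>p\<close> between the times \<open>T - h\<close> and \<open>T + h\<close>, and is at these two times on the same sides
    of the line as the periodic one.\<close>
  define \<mu> where "\<mu> = min (min \<rho> r) (min (- g (T - h)) (g (T + h)) / norm v)"
  have "\<mu> > 0" using \<rho>(1) \<open>r > 0\<close> g_signs \<open>v \<noteq> 0\<close> by (simp add: \<mu>_def)
  \<comment> \<open>The exponential compensates the divergence of solutions up to the time \<open>T + h\<close>.\<close>
  define s where "s = \<mu> / (2 * norm v * exp (L * (T + h)))"
  have "s > 0" using \<open>\<mu> > 0\<close> \<open>v \<noteq> 0\<close> by (simp add: s_def)
  obtain \<delta> where \<delta>0: "\<delta> 0 = p + s *\<^sub>R w"
    and \<delta>: "\<And>t. (\<delta> has_vector_derivative F (\<delta> t)) (at t)"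
    using lipschitz_imp_global_solution[OF lip, of "p + s *\<^sub>R w"] by blast
  then have sol_\<delta>: "solution_of F \<delta>" by (simp add: solution_of_def)
  have close: "dist (\<delta> t) (\<gamma> t) < \<mu>" if "0 \<le> t" "t \<le> T + h" for t
  proof -
    have "dist (\<delta> t) (\<gamma> t) \<le> dist (\<delta> 0) (\<gamma> 0) * exp (L * \<bar>t\<bar>)"
      by (rule solution_distance_growth[OF lip \<delta> D])
    also have "dist (\<delta> 0) (\<gamma> 0) = s * norm v"
      using \<open>s > 0\<close> by (simp add: \<delta>0 dist_norm norm_w flip: p_def)
    also have "s * norm v * exp (L * \<bar>t\<bar>) \<le> s * norm v * exp (L * (T + h))"
      using that \<open>s > 0\<close> \<open>L \<ge> 0\<close> by (auto intro!: mult_left_mono)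
    also have "\<dots> = \<mu> / 2" using \<open>v \<noteq> 0\<close> by (simp add: s_def)
    also have "\<dots> < \<mu>" using \<open>\<mu> > 0\<close> by simp
    finally show ?thesis .
  qed
  have \<mu>_le: "\<mu> \<le> \<rho>" "\<mu> \<le> r" "norm v * \<mu> \<le> - g (T - h)" "norm v * \<mu> \<le> g (T + h)"
  proof -
    have "\<mu> \<le> min (- g (T - h)) (g (T + h)) / norm v" by (simp add: \<mu>_def)
    then have "norm v * \<mu> \<le> min (- g (T - h)) (g (T + h))"
      using \<open>v \<noteq> 0\<close> by (simp add: field_simps)
    then show "norm v * \<mu> \<le> - g (T - h)" "norm v * \<mu> \<le> g (T + h)" by auto
  qed (simp_all add: \<mu>_def)
  have g_close: "\<bar>v \<bullet> (\<delta> t - p) - g t\<bar> < norm v * \<mu>" if "0 \<le> t" "t \<le> T + h" for t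
  proof -
    have "\<bar>v \<bullet> (\<delta> t - p) - g t\<bar> = \<bar>v \<bullet> (\<delta> t - \<gamma> t)\<bar>"
      by (simp add: g_def inner_diff_right)
    also have "\<dots> \<le> norm v * norm (\<delta> t - \<gamma> t)" by (rule Cauchy_Schwarz_ineq2)
    also have "\<dots> < norm v * \<mu>"
      using close[OF that] \<open>v \<noteq> 0\<close> by (simp add: dist_norm)
    finally show ?thesis .
  qed
  have "continuous_on {T - h..T + h} (\<lambda>t. v \<bullet> (\<delta> t - p))"
    using \<delta> by (intro continuous_intros)
      (meson continuous_at_imp_continuous_on has_vector_derivative_continuous)
  moreover have "v \<bullet> (\<delta> (T - h) - p) \<le> 0" "0 \<le> v \<bullet> (\<delta> (T + h) - p)"
    using g_close[of "T - h"] g_close[of "T + h"] \<mu>_le h T(1) by (auto simp: abs_less_iff)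
  ultimately obtain \<tau> where \<tau>: "T - h \<le> \<tau>" "\<tau> \<le> T + h" "v \<bullet> (\<delta> \<tau> - p) = 0"
    using IVT'[of "\<lambda>t. v \<bullet> (\<delta> t - p)" "T - h" 0 "T + h"] h(1) by auto
  have "\<tau> > 0" using \<tau>(1) h(5) by simp
  obtain s' where s': "\<delta> \<tau> - p = s' *\<^sub>R w"
    using orthogonal_in_plane[OF \<tau>(3) \<open>v \<noteq> 0\<close>] unfolding w_def by blast
  have small: "L * \<bar>a\<bar> < 1" if "\<bar>a\<bar> * norm v < 2 * r" for a
  proof -
    have "\<bar>a\<bar> * norm v * (L + 1) < norm v"
      using that \<open>L \<ge> 0\<close> by (simp add: r_def field_simps)
    then have "(\<bar>a\<bar> * (L + 1)) * norm v < 1 * norm v" by (simp add: ac_simps)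
    then have "\<bar>a\<bar> * (L + 1) < 1" using \<open>v \<noteq> 0\<close> by (simp only: mult_less_cancel_right) auto
    then show ?thesis by (simp add: algebra_simps)
  qed
  have on_section: "a = b"
    if "L * \<bar>a\<bar> < 1" "L * \<bar>b\<bar> < 1" "H (p + a *\<^sub>R w) = H (p + b *\<^sub>R w)" for a b
    by (rule hamiltonian_inj_on_section[OF ham lip _ _ that])
      (use \<open>v \<noteq> 0\<close> in \<open>simp_all add: v_def w_def\<close>)
  have "dist (\<delta> 0) (\<gamma> 0) = s * norm v"
    using \<open>s > 0\<close> by (simp add: \<delta>0 dist_norm norm_w flip: p_def)
  then have "L * \<bar>s\<bar> < 1"
    using close[of 0] \<mu>_le(2) h(1) T(1) \<open>s > 0\<close> \<open>r > 0\<close> by (intro small) auto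
  moreover have "L * \<bar>s'\<bar> < 1"
  proof (rule small)
    have "\<bar>s'\<bar> * norm v = dist (\<delta> \<tau>) p" using s' by (simp add: dist_norm norm_w)
    also have "\<dots> \<le> dist (\<delta> \<tau>) (\<gamma> \<tau>) + dist (\<gamma> \<tau>) p" by (rule dist_triangle)
    also have "\<dots> < r + r"
      using close[of \<tau>] d3[of \<tau>] \<tau> \<open>\<tau> > 0\<close> h(4) \<mu>_le(2) by (intro add_strict_mono) auto
    finally show "\<bar>s'\<bar> * norm v < 2 * r" by simp
  qed
  moreover have "H (p + s *\<^sub>R w) = H (p + s' *\<^sub>R w)"
    using solution_conserves_hamiltonian[OF ham sol_\<delta>, of 0 \<tau>] s' \<delta>0 by (simp add: algebra_simps)
  ultimately have "s = s'" by (rule on_section)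
  then have return: "\<delta> \<tau> = \<delta> 0" using s' \<delta>0 by (simp add: algebra_simps)
  have H_neq: "H (\<delta> 0) \<noteq> H p"
  proof
    assume "H (\<delta> 0) = H p"
    then have "s = 0"
      using on_section[of s 0] \<open>L * \<bar>s\<bar> < 1\<close> by (simp add: \<delta>0)
    with \<open>s > 0\<close> show False by simp
  qed
  have "F (\<delta> 0) \<noteq> 0"
  proof
    assume "F (\<delta> 0) = 0"
    then have "dist v 0 \<le> L * dist p (\<delta> 0)"
      using lipschitz_onD[OF lip, of p "\<delta> 0"] by (simp add: v_def)
    also have "dist p (\<delta> 0) = s * norm v"
      using \<open>s > 0\<close> by (simp add: \<delta>0 dist_norm norm_w)
    finally show False using \<open>L * \<bar>s\<bar> < 1\<close> \<open>s > 0\<close> \<open>v \<noteq> 0\<close>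
      by (simp add: mult.assoc[symmetric] mult_le_cancel_right1)
  qed
  note orbit = solution_return_imp_periodic_orbit[OF lip sol_\<delta> \<open>\<tau> > 0\<close> return this]
  have "range \<delta> \<subseteq> U"
  proof -
    have "\<delta> t \<in> U" if "t \<in> {0..\<tau>}" for t
    proof -
      have "\<delta> t \<in> ball (\<gamma> t) \<rho>"
        using close[of t] that \<tau>(2) \<mu>_le(1) by (simp add: dist_commute)
      then show ?thesis using \<rho>(2) \<Gamma> by blast
    qed
    then show ?thesis using orbit(2) by auto
  qed
  with isolated orbit(1) have "range \<delta> = \<Gamma>" by blast
  then obtain t where "\<delta> 0 = \<gamma> t" unfolding \<Gamma> by (metis rangeE rangeI)
  then show False
    using H_neq solution_conserves_hamiltonian[OF ham sol, of t 0] by (simp add: p_def)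
qed

section \<open>The fields glued along a line\<close>

lemma hamiltonian_field_add:
  assumes "hamiltonian_field F H" "hamiltonian_field G K"
  shows "hamiltonian_field (\<lambda>p. F p + G p) (\<lambda>p. H p + K p)"
  unfolding hamiltonian_field_def
proof
  fix p
  have "((\<lambda>p. H p + K p) has_derivative (\<lambda>u. (fst (F p) * snd u - snd (F p) * fst u)
      + (fst (G p) * snd u - snd (G p) * fst u))) (at p)"
    using assms unfolding hamiltonian_field_def by (intro has_derivative_add) blast+
  then show "((\<lambda>p. H p + K p) has_derivative
      (\<lambda>u. fst (F p + G p) * snd u - snd (F p + G p) * fst u)) (at p)"
    by (rule has_derivative_eq_rhs) (auto simp: algebra_simps)
qed

lemma linear_hamiltonian_imp_hamiltonian_field:
  assumes "linear_hamiltonian X"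
  shows "\<exists>H. hamiltonian_field X H"
proof -
  obtain a b c \<alpha> \<beta> where X: "\<And>x y. X (x, y) = (a * x + b * y + \<alpha>, c * x - a * y + \<beta>)"
    using assms unfolding linear_hamiltonian_def by blast
  let ?H = "\<lambda>p::plane. b / 2 * (snd p)\<^sup>2 - c / 2 * (fst p)\<^sup>2 + a * fst p * snd p + \<alpha> * snd p - \<beta> * fst p"
  have "(?H has_derivative (\<lambda>u. fst (X p) * snd u - snd (X p) * fst u)) (at p)" for p
    by (cases p) (auto intro!: derivative_eq_intros simp: X fun_eq_iff algebra_simps)
  then show ?thesis unfolding hamiltonian_field_def by blast
qed

lemma linear_hamiltonian_imp_lipschitz:
  assumes "linear_hamiltonian X"
  shows "\<exists>L. L-lipschitz_on UNIV X"
proof -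
  obtain a b c \<alpha> \<beta> where X: "\<And>x y. X (x, y) = (a * x + b * y + \<alpha>, c * x - a * y + \<beta>)"
    using assms unfolding linear_hamiltonian_def by blast
  let ?A = "\<lambda>p::plane. (a * fst p + b * snd p, c * fst p - a * snd p)"
  have "bounded_linear ?A"
    by (intro bounded_linear_Pair bounded_linear_add bounded_linear_sub
        bounded_linear_const_mult bounded_linear_fst bounded_linear_snd)
  then obtain B where "B-lipschitz_on UNIV ?A"
    using bounded_linear.lipschitz_boundE by blast
  then have "(B + 0)-lipschitz_on UNIV (\<lambda>p. ?A p + (\<alpha>, \<beta>))"
    by (rule lipschitz_on_add[OF _ lipschitz_on_constant])
  moreover have "X = (\<lambda>p. ?A p + (\<alpha>, \<beta>))"
    by (auto simp: X fun_eq_iff)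
  ultimately show ?thesis by metis
qed

text \<open>The vector \<open>(- snd n, fst n)\<close> is the quarter turn of \<open>n\<close>, so the field is parallel to the line
  \<open>n \<bullet> p = k\<close>; it vanishes on the side where \<open>n \<bullet> p \<ge> k\<close>.\<close>

definition ramp_field :: "plane \<Rightarrow> real \<Rightarrow> plane \<Rightarrow> plane" where
  "ramp_field n k p = max 0 (k - n \<bullet> p) *\<^sub>R (- snd n, fst n)"

lemma half_square_max_deriv:
  "((\<lambda>x::real. (max 0 x)\<^sup>2 / 2) has_real_derivative max 0 x) (at x)"
proof (cases x "0 :: real" rule: linorder_cases)
  case less
  have "((\<lambda>_. 0) has_real_derivative 0) (at x)" by simp
  then have "((\<lambda>x::real. (max 0 x)\<^sup>2 / 2) has_real_derivative 0) (at x)"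
    by (rule has_field_derivative_transform_within_open[of _ _ _ "{..<0}"])
      (use less in \<open>auto simp: max_def\<close>)
  then show ?thesis using less by simp
next
  case equal
  have "((\<lambda>h::real. (max 0 (0 + h))\<^sup>2 / 2 / h) \<longlongrightarrow> 0) (at 0)"
  proof (rule Lim_null_comparison)
    show "\<forall>\<^sub>F h in at 0. norm ((max 0 (0 + h))\<^sup>2 / 2 / h) \<le> \<bar>h\<bar>"
      by (auto simp: max_def power2_eq_square intro!: always_eventually)
    show "((\<lambda>h::real. \<bar>h\<bar>) \<longlongrightarrow> 0) (at 0)" by (rule tendsto_rabs_zero) (rule tendsto_ident_at)
  qed
  then show ?thesis using equal by (simp add: DERIV_def)
next
  case greater
  have "((\<lambda>x. x\<^sup>2 / 2) has_real_derivative x) (at x)"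
    by (auto intro!: derivative_eq_intros)
  then have "((\<lambda>x::real. (max 0 x)\<^sup>2 / 2) has_real_derivative x) (at x)"
    by (rule has_field_derivative_transform_within_open[of _ _ _ "{0<..}"])
      (use greater in \<open>auto simp: max_def\<close>)
  then show ?thesis using greater by simp
qed

lemma ramp_field_hamiltonian:
  "hamiltonian_field (\<lambda>p. \<nu> *\<^sub>R ramp_field n k p) (\<lambda>p. \<nu> * ((max 0 (k - n \<bullet> p))\<^sup>2 / 2))"
  unfolding hamiltonian_field_def
proof
  fix p
  have "((\<lambda>p. k - n \<bullet> p) has_derivative (\<lambda>u. - (n \<bullet> u))) (at p)"
    by (auto intro!: derivative_eq_intros)
  moreover have "((\<lambda>x. (max 0 x)\<^sup>2 / 2) has_derivative (\<lambda>h. h * max 0 (k - n \<bullet> p))) (at (k - n \<bullet> p))"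
    using half_square_max_deriv[of "k - n \<bullet> p"]
    by (simp add: has_field_derivative_def mult_commute_abs)
  ultimately have "((\<lambda>p. (max 0 (k - n \<bullet> p))\<^sup>2 / 2) has_derivative
      (\<lambda>u. - (n \<bullet> u) * max 0 (k - n \<bullet> p))) (at p)"
    by (rule has_derivative_compose)
  then have "((\<lambda>p. \<nu> * ((max 0 (k - n \<bullet> p))\<^sup>2 / 2)) has_derivative
      (\<lambda>u. \<nu> * (- (n \<bullet> u) * max 0 (k - n \<bullet> p)))) (at p)"
    by (rule has_derivative_mult_right)
  then show "((\<lambda>p. \<nu> * ((max 0 (k - n \<bullet> p))\<^sup>2 / 2)) has_derivative
      (\<lambda>u. fst (\<nu> *\<^sub>R ramp_field n k p) * snd u - snd (\<nu> *\<^sub>R ramp_field n k p) * fst u)) (at p)"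
    by (rule has_derivative_eq_rhs)
      (auto simp: ramp_field_def inner_prod_def fun_eq_iff algebra_simps)
qed

lemma ramp_field_lipschitz:
  "\<exists>L. L-lipschitz_on UNIV (ramp_field n k)"
proof (intro exI lipschitz_onI)
  fix p q :: plane
  have "\<bar>max 0 (k - n \<bullet> p) - max 0 (k - n \<bullet> q)\<bar> \<le> \<bar>n \<bullet> (p - q)\<bar>"
    by (auto simp: inner_diff_right max_def)
  also have "\<dots> \<le> norm n * norm (p - q)" by (rule Cauchy_Schwarz_ineq2)
  finally have "\<bar>max 0 (k - n \<bullet> p) - max 0 (k - n \<bullet> q)\<bar> * norm (- snd n, fst n)
      \<le> norm n * norm (p - q) * norm (- snd n, fst n)"
    by (rule mult_right_mono) simp
  then show "dist (ramp_field n k p) (ramp_field n k q) \<le> (norm n * norm (- snd n, fst n)) * dist p q"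
    by (simp add: ramp_field_def dist_norm ac_simps flip: scaleR_diff_left del: scaleR_Pair)
qed simp

text \<open>The difference of the two fields vanishes on the line, so its linear part maps the direction
  \<open>(- snd n, fst n)\<close> to 0. A trace-free 2 by 2 matrix of rank at most one has its range in
  its kernel; so the difference is everywhere parallel to the line, with a size proportional to \<open>k - n \<bullet> p\<close>.\<close>

lemma linear_hamiltonian_agree_on_line:
  assumes X: "linear_hamiltonian X" and Y: "linear_hamiltonian Y" and "n \<noteq> 0"
    and agree: "\<And>p. n \<bullet> p = k \<Longrightarrow> X p = Y p"
  shows "\<exists>\<nu>. \<forall>p. X p = Y p + (\<nu> * (k - n \<bullet> p)) *\<^sub>R (- snd n, fst n)"
proof -
  obtain a b c \<alpha> \<beta> where Xeq: "\<And>x y. X (x, y) = (a * x + b * y + \<alpha>, c * x - a * y + \<beta>)"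
    using X unfolding linear_hamiltonian_def by blast
  obtain a' b' c' \<alpha>' \<beta>' where Yeq: "\<And>x y. Y (x, y) = (a' * x + b' * y + \<alpha>', c' * x - a' * y + \<beta>')"
    using Y unfolding linear_hamiltonian_def by blast
  \<comment> \<open>Coefficients of the difference \<open>X - Y\<close>, which vanishes at the foot \<open>(x0, y0)\<close> of the
    perpendicular from the origin and at its translate along the line.\<close>
  define A B C E G where "A = a - a'" "B = b - b'" "C = c - c'" "E = \<alpha> - \<alpha>'" "G = \<beta> - \<beta>'"
  note diffs = this
  obtain m1 m2 where n: "n = (m1, m2)" by (cases n)
  define N where "N = m1 * m1 + m2 * m2"
  have "N \<noteq> 0" using \<open>n \<noteq> 0\<close> unfolding N_def n by (simp add: zero_prod_def)
  define x0 y0 where "x0 = k * m1 / N" "y0 = k * m2 / N"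
  have on_line: "m1 * x0 + m2 * y0 = k"
  proof -
    have "m1 * x0 + m2 * y0 = k * N / N" unfolding x0_y0_def N_def by (simp add: algebra_simps add_divide_distrib)
    then show ?thesis using \<open>N \<noteq> 0\<close> by simp
  qed
  have zero1: "A * x0 + B * y0 + E = 0" "C * x0 - A * y0 + G = 0"
    using agree[of "(x0, y0)"] on_line by (auto simp: n Xeq Yeq diffs algebra_simps)
  have zero2: "A * (x0 - m2) + B * (y0 + m1) + E = 0" "C * (x0 - m2) - A * (y0 + m1) + G = 0"
    using agree[of "(x0 - m2, y0 + m1)"] on_line by (auto simp: n Xeq Yeq diffs algebra_simps)
  have kernel: "B * m1 = A * m2" "C * m2 = - A * m1"
    using zero1 zero2 by (simp_all add: algebra_simps)
  show ?thesis
  proof (intro exI allI)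
    fix p :: plane
    obtain x y where p: "p = (x, y)" by (cases p)
    have "N * (A * x + B * y + E) = (B - C) * (k - (m1 * x + m2 * y)) * - m2"
      using zero1(1) kernel on_line unfolding N_def by algebra
    moreover have "N * (C * x - A * y + G) = (B - C) * (k - (m1 * x + m2 * y)) * m1"
      using zero1(2) kernel on_line unfolding N_def by algebra
    ultimately show "X p = Y p + ((B - C) / N * (k - n \<bullet> p)) *\<^sub>R (- snd n, fst n)"
      using \<open>N \<noteq> 0\<close> by (auto simp: p n Xeq Yeq diffs field_simps)
  qed
qed

section \<open>The three zones\<close>

lemma line_equation_unique:
  fixes n m :: plane
  assumes eq: "{p. n \<bullet> p = k} = {p. m \<bullet> p = l}" and "n \<noteq> 0" "m \<noteq> 0"
  obtains c where "c \<noteq> 0" "m = c *\<^sub>R n" "l = c * k"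
proof -
  define q where "q = (k / (n \<bullet> n)) *\<^sub>R n"
  define w where "w = (- snd n, fst n)"
  have "w \<noteq> 0" using \<open>n \<noteq> 0\<close> by (auto simp: w_def zero_prod_def prod_eq_iff)
  have "n \<bullet> w = 0" by (simp add: w_def inner_prod_def)
  have "n \<bullet> q = k" using \<open>n \<noteq> 0\<close> by (simp add: q_def)
  then have "n \<bullet> q = k" "n \<bullet> (q + w) = k" using \<open>n \<bullet> w = 0\<close> by (simp_all add: inner_add_right)
  then have m: "m \<bullet> q = l" "m \<bullet> (q + w) = l" using eq by blast+
  then have "w \<bullet> m = 0" by (simp add: inner_add_right inner_commute)
  then obtain c where "m = c *\<^sub>R (- snd w, fst w)"
    using orthogonal_in_plane \<open>w \<noteq> 0\<close> by metis
  then have "m = (- c) *\<^sub>R n" by (simp add: w_def prod_eq_iff)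
  moreover have "l = (- c) * k" using m(1) \<open>n \<bullet> q = k\<close> calculation by simp
  moreover have "- c \<noteq> 0" using \<open>m \<noteq> 0\<close> calculation(1) by auto
  ultimately show ?thesis using that by blast
qed

text \<open>A half-plane bounded by one of two parallel lines contains the other line unless it lies on the
  side away from it. So the two outer zones are on opposite sides, and both are described
  by one normal vector.\<close>

lemma parallel_zones_normal_form:
  assumes parallel: "affine_parallel \<Sigma>L \<Sigma>R" "\<Sigma>L \<noteq> \<Sigma>R"
    and left_zone: "open_half_plane \<Sigma>L RL" "\<not> \<Sigma>R \<subseteq> RL"
    and right_zone: "open_half_plane \<Sigma>R RR" "\<not> \<Sigma>L \<subseteq> RR"
  obtains n k l where "n \<noteq> 0" "k < l"
    "\<Sigma>L = {p. n \<bullet> p = k}" "RL = {p. n \<bullet> p < k}" "\<Sigma>R = {p. n \<bullet> p = l}" "RR = {p. l < n \<bullet> p}"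
proof -
  obtain n k where n: "n \<noteq> 0" and \<Sigma>L: "\<Sigma>L = {p. n \<bullet> p = k}" and RL: "RL = {p. n \<bullet> p < k}"
    using left_zone(1) unfolding open_half_plane_def by blast
  obtain m j where m: "m \<noteq> 0" and \<Sigma>R': "\<Sigma>R = {p. m \<bullet> p = j}" and RR: "RR = {p. m \<bullet> p < j}"
    using right_zone(1) unfolding open_half_plane_def by blast
  obtain a where a: "\<Sigma>R = (\<lambda>x. a + x) ` \<Sigma>L"
    using parallel(1) unfolding affine_parallel_def by blast
  define l where "l = k + n \<bullet> a"
  have \<Sigma>R: "\<Sigma>R = {p. n \<bullet> p = l}"
  proof (intro set_eqI iffI)
    fix p assume "p \<in> {p. n \<bullet> p = l}"
    then have "p - a \<in> \<Sigma>L" by (simp add: \<Sigma>L l_def inner_diff_right)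
    then show "p \<in> \<Sigma>R" unfolding a by (metis add_diff_cancel_left' diff_add_cancel add.commute image_eqI)
  qed (auto simp: a \<Sigma>L l_def inner_add_right)
  have "k < l" using left_zone(2) parallel(2) by (auto simp: \<Sigma>L \<Sigma>R RL)
  obtain c where c: "c \<noteq> 0" "m = c *\<^sub>R n" "j = c * l"
    using line_equation_unique[of n l m j] n m \<Sigma>R \<Sigma>R' by metis
  have "\<not> c > 0"
  proof
    assume "c > 0"
    then have "RR = {p. n \<bullet> p < l}" by (simp add: RR c)
    with right_zone(2) \<open>k < l\<close> show False by (auto simp: \<Sigma>L)
  qed
  with c(1) have "c < 0" by simp
  then have "RR = {p. l < n \<bullet> p}" by (simp add: RR c)
  with n \<open>k < l\<close> \<Sigma>L RL \<Sigma>R show ?thesis using that by blast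
qed

lemma open_strip_between:
  fixes n :: plane
  assumes "n \<noteq> 0" "k < l"
  shows "open_strip {p. n \<bullet> p = k} {p. n \<bullet> p = l} = {p. k < n \<bullet> p \<and> n \<bullet> p < l}"
proof (intro set_eqI iffI)
  fix p assume "p \<in> open_strip {p. n \<bullet> p = k} {p. n \<bullet> p = l}"
  then obtain q r u where qr: "n \<bullet> q = k" "n \<bullet> r = l" and u: "0 < u" "u < 1"
    and p: "p = (1 - u) *\<^sub>R q + u *\<^sub>R r"
    unfolding open_strip_def by (auto simp: in_segment)
  have "n \<bullet> p = k + u * (l - k)" by (simp add: p inner_add_right qr algebra_simps)
  moreover have "0 < u * (l - k)" "u * (l - k) < 1 * (l - k)"
    using u \<open>k < l\<close> by (auto intro!: mult_strict_right_mono)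
  ultimately show "p \<in> {p. k < n \<bullet> p \<and> n \<bullet> p < l}" by simp
next
  fix p assume "p \<in> {p. k < n \<bullet> p \<and> n \<bullet> p < l}"
  then have p: "k < n \<bullet> p" "n \<bullet> p < l" by auto
  define e where "e = (1 / (n \<bullet> n)) *\<^sub>R n"
  define q r where "q = p + (k - n \<bullet> p) *\<^sub>R e" "r = p + (l - n \<bullet> p) *\<^sub>R e"
  have e: "n \<bullet> e = 1" using \<open>n \<noteq> 0\<close> by (simp add: e_def)
  have qr: "n \<bullet> q = k" "n \<bullet> r = l" by (simp_all add: q_r_def inner_add_right e)
  define u where "u = (n \<bullet> p - k) / (l - k)"
  have u: "0 < u" "u < 1" using p by (auto simp: u_def)
  have "u * (l - k) = n \<bullet> p - k" using \<open>k < l\<close> by (simp add: u_def)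
  then have coeff: "(1 - u) * (k - n \<bullet> p) + u * (l - n \<bullet> p) = 0" by (simp add: algebra_simps)
  have "(1 - u) *\<^sub>R q + u *\<^sub>R r
      = ((1 - u) + u) *\<^sub>R p + ((1 - u) * (k - n \<bullet> p) + u * (l - n \<bullet> p)) *\<^sub>R e"
    unfolding q_r_def by (simp only: scaleR_add_left scaleR_add_right scaleR_scaleR) (simp add: algebra_simps)
  then have "p = (1 - u) *\<^sub>R q + u *\<^sub>R r" unfolding coeff by simp
  moreover have "q \<noteq> r" using qr \<open>k < l\<close> by auto
  ultimately have "p \<in> open_segment q r" using u unfolding in_segment by blast
  then show "p \<in> open_strip {p. n \<bullet> p = k} {p. n \<bullet> p = l}"
    unfolding open_strip_def using qr by blast
qed

text \<open>The right-hand ramp is written with the normal \<open>- n\<close> and the level \<open>- l\<close>, since it is active where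
  \<open>n \<bullet> p > l\<close>. On the two lines both ramps vanish, so the order of the cases does not matter.\<close>

lemma three_zone_field_eq_ramps:
  assumes n: "n \<noteq> 0" and "k < l"
    and zones: "RL = {p. n \<bullet> p < k}" "RC = {p. k < n \<bullet> p \<and> n \<bullet> p < l}" "RR = {p. l < n \<bullet> p}"
    and XL: "\<And>p. XL p = XC p + (\<nu> * (k - n \<bullet> p)) *\<^sub>R (- snd n, fst n)"
    and XR: "\<And>p. XR p = XC p + (\<mu> * (- l - (- n) \<bullet> p)) *\<^sub>R (- snd (- n), fst (- n))"
  shows "three_zone_field RL RC RR XL XC XR p
    = XC p + (\<nu> *\<^sub>R ramp_field n k p + \<mu> *\<^sub>R ramp_field (- n) (- l) p)"
proof -
  have RL: "closure RL = {p. n \<bullet> p \<le> k}" and RR: "closure RR = {p. l \<le> n \<bullet> p}"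
    using n by (simp_all add: zones)
  have "closed ({p. k \<le> n \<bullet> p} \<inter> {p. n \<bullet> p \<le> l})"
    by (intro closed_Int closed_halfspace_ge closed_halfspace_le)
  then have "closure RC \<subseteq> {p. k \<le> n \<bullet> p} \<inter> {p. n \<bullet> p \<le> l}"
    by (rule closure_minimal[rotated]) (auto simp: zones)
  then have RC: "n \<bullet> p \<le> l" if "p \<in> closure RC" using that by auto
  consider "n \<bullet> p \<le> k" | "k < n \<bullet> p" "p \<in> closure RC" | "k < n \<bullet> p" "p \<notin> closure RC" by linarith
  then show ?thesis
  proof cases
    case 1
    then show ?thesis using \<open>k < l\<close>
      by (simp add: three_zone_field_def RL XL ramp_field_def)
  next
    case 2
    then show ?thesis using RC
      by (simp add: three_zone_field_def RL ramp_field_def zero_prod_def)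
  next
    case 3
    then have "l \<le> n \<bullet> p" using closure_subset[of RC] by (force simp: zones)
    then show ?thesis using 3
      by (simp add: three_zone_field_def RL RR XR ramp_field_def)
  qed
qed

theorem theorem2:
  fixes \<Sigma>L \<Sigma>R RL RC RR :: "plane set"
    and XL XC XR :: "plane \<Rightarrow> plane"
  assumes lines: "straight_line \<Sigma>L" "straight_line \<Sigma>R"
    and parallel: "affine_parallel \<Sigma>L \<Sigma>R" "\<Sigma>L \<noteq> \<Sigma>R"
    and center_zone: "RC = open_strip \<Sigma>L \<Sigma>R"
    and left_zone: "open_half_plane \<Sigma>L RL" "\<not> \<Sigma>R \<subseteq> RL"
    and right_zone: "open_half_plane \<Sigma>R RR" "\<not> \<Sigma>L \<subseteq> RR"
    and hamiltonian: "linear_hamiltonian XL" "linear_hamiltonian XC" "linear_hamiltonian XR"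
    and singular: "has_isolated_singular_point XL" "has_isolated_singular_point XC"
      "has_isolated_singular_point XR"
    and continuous_left: "\<And>p. p \<in> \<Sigma>L \<Longrightarrow> XL p = XC p"
    and continuous_right: "\<And>q. q \<in> \<Sigma>R \<Longrightarrow> XC q = XR q"
  shows "\<not> (\<exists>\<Gamma>. limit_cycle (three_zone_field RL RC RR XL XC XR) \<Gamma>)"
proof -
  obtain n k l where n: "n \<noteq> 0" "k < l"
    and \<Sigma>L: "\<Sigma>L = {p. n \<bullet> p = k}" and RL: "RL = {p. n \<bullet> p < k}"
    and \<Sigma>R: "\<Sigma>R = {p. n \<bullet> p = l}" and RR: "RR = {p. l < n \<bullet> p}"
    using parallel_zones_normal_form[OF parallel left_zone right_zone] by metis
  have RC: "RC = {p. k < n \<bullet> p \<and> n \<bullet> p < l}"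
    unfolding center_zone \<Sigma>L \<Sigma>R by (rule open_strip_between[OF n])
  obtain \<nu> where XL: "\<And>p. XL p = XC p + (\<nu> * (k - n \<bullet> p)) *\<^sub>R (- snd n, fst n)"
    using linear_hamiltonian_agree_on_line[OF hamiltonian(1,2) n(1), of k] continuous_left \<Sigma>L
    by auto
  have "- n \<noteq> 0" using n(1) by simp
  moreover have "XR p = XC p" if "- n \<bullet> p = - l" for p
    using that continuous_right[of p] by (simp add: \<Sigma>R)
  ultimately obtain \<mu> where
    XR: "\<And>p. XR p = XC p + (\<mu> * (- l - (- n) \<bullet> p)) *\<^sub>R (- snd (- n), fst (- n))"
    using linear_hamiltonian_agree_on_line[OF hamiltonian(3,2)] by blast
  let ?F = "\<lambda>p. XC p + (\<nu> *\<^sub>R ramp_field n k p + \<mu> *\<^sub>R ramp_field (- n) (- l) p)"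
  have F: "three_zone_field RL RC RR XL XC XR = ?F"
    using three_zone_field_eq_ramps[OF n RL RC RR XL XR] by blast
  obtain H where "hamiltonian_field XC H"
    using linear_hamiltonian_imp_hamiltonian_field[OF hamiltonian(2)] by blast
  note ham = hamiltonian_field_add[OF this
      hamiltonian_field_add[OF ramp_field_hamiltonian ramp_field_hamiltonian]]
  obtain L1 L2 L3 where "L1-lipschitz_on UNIV XC"
    and "L2-lipschitz_on UNIV (ramp_field n k)" "L3-lipschitz_on UNIV (ramp_field (- n) (- l))"
    using linear_hamiltonian_imp_lipschitz[OF hamiltonian(2)] ramp_field_lipschitz by metis
  then have lip: "(L1 + (\<bar>\<nu>\<bar> * L2 + \<bar>\<mu>\<bar> * L3))-lipschitz_on UNIV ?F"
    by (intro lipschitz_on_add lipschitz_on_cmult)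
  show ?thesis
    unfolding F using lipschitz_hamiltonian_no_limit_cycle[OF ham lip] by blast
qed

end
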